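(* Let $h(\gamma)$ be a performance metric depending on the instantaneous signal-to-noise ratio (SNR) $\gamma$, and let $\overline{h}_R(\overline{\gamma})$ be the metric in Rayleigh fading with average SNR $\overline{\gamma}$ obtained by averaging over an interval of the pdf of the SNR, i.e., $$\overline{h}_R(\overline{\gamma})=\int_a^b h(x)\,\frac{1}{\overline{\gamma}}e^{-x/\overline{\gamma}}\,dx,$$ with $0\le a<b\le\infty$. Let $q\in[0,1]$. Then the performance metric in Hoyt fading channels with average SNR $\overline{\gamma}$ and parameter $q$, namely $\overline{h}_H(\overline{\gamma})=\int_a^b h(x)f(x)\,dx$ with $f$ the pdf of the squared Hoyt distribution with average $\overline{\gamma}$ and parameter $q$, can be calculated as $$\overline{h}_H(\overline{\gamma})=\frac{1}{\pi}\int_0^\pi\overline{h}_R(\gamma(\theta,q))\,d\theta=\mathcal{H}\left\{\overline{h}_R(\overline{\gamma});q\right\},\qquad \gamma(\theta,q)=\overline{\gamma}\left(1-\frac{1-q^2}{1+q^2}\cos\theta\right),$$ where $\mathcal{H}\{\cdot;q\}$ is the Hoyt transform operation, i.e. the operation defined by this integral over $\theta$.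
   Context: In Rayleigh fading the SNR is exponentially distributed; in Hoyt fading it follows the squared Hoyt distribution. The squared Hoyt distribution is the distribution of $X^2+Y^2$, where $X,Y$ are independent zero-mean Gaussian random variables with variances $\sigma_x^2$ and $\sigma_y^2$, $\sigma_y\le\sigma_x$. Its parameters are the average $\overline{\gamma}=\mathbb{E}\{X^2+Y^2\}$ and $q=\sigma_y/\sigma_x\in[0,1]$. Its pdf on $[0,\infty)$ is used in the integral form $$f(x)=\frac{1}{\pi}\int_0^\pi\frac{1}{\gamma(\theta,q)}e^{-x/\gamma(\theta,q)}\,d\theta,$$ which is an alternative expression for $\frac{1+q^2}{2q\overline{\gamma}}\exp\left[-\frac{(1+q^2)^2x}{4q^2\overline{\gamma}}\right]I_0\left(\frac{(1-q^4)x}{4q^2\overline{\gamma}}\right)$, with $I_0$ the modified Bessel function of the first kind and order zero. *)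

theory Defs
  imports "HOL-Probability.Probability"
begin

text \<open>The point mass at \<open>0\<close> is the degenerate Gaussian of variance \<open>0\<close>; it is needed for the
  case \<open>q = 0\<close> of the Hoyt family.\<close>

definition zero_mean_gaussian :: "real \<Rightarrow> real measure" where
  "zero_mean_gaussian \<sigma> =
     (if \<sigma> = 0 then return borel 0
      else density lborel (\<lambda>x. ennreal (normal_density 0 \<sigma> x)))"

definition squared_hoyt :: "'a measure \<Rightarrow> ('a \<Rightarrow> real) \<Rightarrow> real \<Rightarrow> real \<Rightarrow> bool" where
  "squared_hoyt M Z \<gamma> q \<longleftrightarrow>
     prob_space M \<and>
     (\<exists>X Y \<sigma>\<^sub>x \<sigma>\<^sub>y. 0 < \<sigma>\<^sub>x \<and> 0 \<le> \<sigma>\<^sub>y \<and> \<sigma>\<^sub>y \<le> \<sigma>\<^sub>x \<and>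
        prob_space.indep_var M borel X borel Y \<and>
        distr M borel X = zero_mean_gaussian \<sigma>\<^sub>x \<and>
        distr M borel Y = zero_mean_gaussian \<sigma>\<^sub>y \<and>
        Z = (\<lambda>\<omega>. (X \<omega>)\<^sup>2 + (Y \<omega>)\<^sup>2) \<and>
        \<gamma> = prob_space.expectation M Z \<and>
        q = \<sigma>\<^sub>y / \<sigma>\<^sub>x)"

definition rayleigh_pdf :: "real \<Rightarrow> real \<Rightarrow> real" where
  "rayleigh_pdf \<gamma> x = 1 / \<gamma> * exp (- x / \<gamma>)"

definition average_metric ::
    "(real \<Rightarrow> real) \<Rightarrow> real \<Rightarrow> ereal \<Rightarrow> (real \<Rightarrow> real) \<Rightarrow> real" where
  "average_metric h a b p = (LBINT x=ereal a..b. h x * p x)"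

definition rayleigh_metric :: "(real \<Rightarrow> real) \<Rightarrow> real \<Rightarrow> ereal \<Rightarrow> real \<Rightarrow> real" where
  "rayleigh_metric h a b \<gamma> = average_metric h a b (rayleigh_pdf \<gamma>)"

definition hoyt_snr :: "real \<Rightarrow> real \<Rightarrow> real \<Rightarrow> real" where
  "hoyt_snr \<gamma> q \<theta> = \<gamma> * (1 - (1 - q\<^sup>2) / (1 + q\<^sup>2) * cos \<theta>)"

definition hoyt_transform :: "(real \<Rightarrow> real) \<Rightarrow> real \<Rightarrow> real \<Rightarrow> real" where
  "hoyt_transform F q \<gamma> = 1 / pi * (LBINT \<theta>=ereal 0..ereal pi. F (hoyt_snr \<gamma> q \<theta>))"

end

theory Submission imports Defs begin

text \<open>
  Write \<open>X = \<sigma>\<^sub>x N\<^sub>1\<close> and \<open>Y = \<sigma>\<^sub>y N\<^sub>2\<close> with independent standard Gaussians, which also covers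
  \<open>\<sigma>\<^sub>y = 0\<close>. In the double integral over \<open>(x, y)\<close> substitute \<open>x = y s\<close>. For fixed \<open>s\<close> the
  substitution \<open>t = (\<sigma>\<^sub>x\<^sup>2 s\<^sup>2 + \<sigma>\<^sub>y\<^sup>2) y\<^sup>2\<close> turns the integral over \<open>y\<close> into one against an exponential
  density, whose mean is \<open>\<gamma>(\<theta>, q)\<close> for \<open>\<theta> = 2 arctan s\<close>; the remaining factor \<open>ds / (1 + s\<^sup>2)\<close> makes
  \<open>\<theta>\<close> uniform. So the squared Hoyt law is a mixture of exponential laws over \<open>\<theta>\<close>, and Fubini's
  theorem exchanges the average of \<open>h\<close> with this mixture.
\<close>

section \<open>Change of variables for nonnegative integrals on half-lines\<close>

text \<open>The rule for compact intervals is applied on each \<open>{a..a + real (Suc n)}\<close>,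
  and monotone convergence does the rest. The image is left as a union so that one statement serves
  both an unbounded \<open>g\<close> (a multiple of the square) and a bounded \<open>g\<close> whose
  supremum is not attained (\<open>arctan\<close>).\<close>

lemma nn_integral_substitution_atLeast:
  fixes f :: "real \<Rightarrow> ennreal" and g g' :: "real \<Rightarrow> real"
  assumes [measurable]: "f \<in> borel_measurable borel"
    and deriv: "\<And>x. a \<le> x \<Longrightarrow> (g has_real_derivative g' x) (at x)"
    and cont: "continuous_on {a..} g'"
    and nonneg: "\<And>x. a \<le> x \<Longrightarrow> 0 \<le> g' x"
  shows "(\<integral>\<^sup>+x. f x * indicator (\<Union>n. {g a..g (a + real (Suc n))}) x \<partial>lborel) =
    (\<integral>\<^sup>+x. f (g x) * g' x * indicator {a..} x \<partial>lborel)"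
proof -
  have mono: "g x \<le> g y" if "a \<le> x" "x \<le> y" for x y
  proof (rule DERIV_nonneg_imp_nondecreasing[OF \<open>x \<le> y\<close>])
    fix z assume "x \<le> z"
    with \<open>a \<le> x\<close> have "a \<le> z"
      by simp
    then show "\<exists>d. (g has_real_derivative d) (at z) \<and> 0 \<le> d"
      using deriv nonneg by blast
  qed
  have exhaust: "{a..} = (\<Union>n. {a..a + real (Suc n)})"
  proof safe
    fix x assume "a \<le> x"
    obtain n where "x - a < real n"
      using reals_Archimedean2 by blast
    with \<open>a \<le> x\<close> show "x \<in> (\<Union>n. {a..a + real (Suc n)})"
      by (auto intro!: exI[of _ n])
  qed auto
  \<comment> \<open>Monotone convergence in the form of continuity from below of the measure with
    density \<open>u\<close>.\<close>
  have union: "(\<integral>\<^sup>+x. u x * indicator (\<Union>n. A n) x \<partial>lborel) = (SUP n. \<integral>\<^sup>+x. u x * indicator (A n) x \<partial>lborel)"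
    if [measurable]: "u \<in> borel_measurable borel" "\<And>n. A n \<in> sets borel" and "incseq A"
    for u :: "real \<Rightarrow> ennreal" and A :: "nat \<Rightarrow> real set"
  proof -
    have "emeasure (density lborel u) (\<Union>n. A n) = (SUP n. emeasure (density lborel u) (A n))"
      using \<open>incseq A\<close> by (intro SUP_emeasure_incseq[symmetric]) auto
    then show ?thesis
      by (simp add: emeasure_density)
  qed
  have "continuous_on {a..} g"
  proof (intro continuous_at_imp_continuous_on ballI)
    fix x assume "x \<in> {a..}"
    then show "isCont g x"
      using deriv[of x] by (simp add: DERIV_isCont)
  qed
  \<comment> \<open>\<open>g\<close> and \<open>g'\<close> are controlled only on
    \<open>{a..}\<close> and need not be measurable elsewhere. Cut off to 0 they become Borel
    functions that agree with the originals wherever the indicator is nonzero.\<close>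
  define G G' where "G x = indicator {a..} x *\<^sub>R g x" and "G' x = indicator {a..} x *\<^sub>R g' x" for x
  have [measurable]: "G \<in> borel_measurable borel"
    unfolding G_def using \<open>continuous_on {a..} g\<close>
    by (intro borel_measurable_continuous_on_indicator) auto
  have [measurable]: "G' \<in> borel_measurable borel"
    unfolding G'_def using cont by (intro borel_measurable_continuous_on_indicator) auto
  let ?u = "\<lambda>x. f (G x) * ennreal (G' x)"
  have um: "?u \<in> borel_measurable borel"
    by measurable
  have "(\<integral>\<^sup>+x. f x * indicator (\<Union>n. {g a..g (a + real (Suc n))}) x \<partial>lborel) =
      (SUP n. \<integral>\<^sup>+x. f x * indicator {g a..g (a + real (Suc n))} x \<partial>lborel)"
  proof (intro union monoI)
    fix m n :: nat assume "m \<le> n"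
    then have "g (a + real (Suc m)) \<le> g (a + real (Suc n))"
      by (intro mono) auto
    then show "{g a..g (a + real (Suc m))} \<le> {g a..g (a + real (Suc n))}"
      by auto
  qed auto
  also have "\<dots> = (SUP n. \<integral>\<^sup>+x. f (g x) * g' x * indicator {a..a + real (Suc n)} x \<partial>lborel)"
  proof (rule SUP_cong)
    fix n
    have "continuous_on {a..a + real (Suc n)} g'"
      using cont by (rule continuous_on_subset) auto
    then show "(\<integral>\<^sup>+x. f x * indicator {g a..g (a + real (Suc n))} x \<partial>lborel) =
        (\<integral>\<^sup>+x. f (g x) * g' x * indicator {a..a + real (Suc n)} x \<partial>lborel)"
      by (intro nn_integral_substitution_aux) (simp_all add: deriv nonneg)
  qed simp
  also have "\<dots> = (SUP n. \<integral>\<^sup>+x. ?u x * indicator {a..a + real (Suc n)} x \<partial>lborel)"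
    by (intro SUP_cong refl nn_integral_cong) (simp add: G_def G'_def split: split_indicator)
  also have "\<dots> = (\<integral>\<^sup>+x. ?u x * indicator (\<Union>n. {a..a + real (Suc n)}) x \<partial>lborel)"
    by (intro union[symmetric] um) (auto simp: incseq_def)
  also have "\<dots> = (\<integral>\<^sup>+x. f (g x) * g' x * indicator {a..} x \<partial>lborel)"
    unfolding exhaust[symmetric] by (intro nn_integral_cong) (simp add: G_def G'_def split: split_indicator)
  finally show ?thesis .
qed

lemma nn_integral_substitution_square:
  fixes f :: "real \<Rightarrow> ennreal"
  assumes [measurable]: "f \<in> borel_measurable borel" and "0 < c"
  shows "(\<integral>\<^sup>+x. f x * indicator {0..} x \<partial>lborel) =
    (\<integral>\<^sup>+x. f (c * x\<^sup>2) * ennreal (2 * c * x) * indicator {0..} x \<partial>lborel)"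
proof -
  have "(\<Union>n. {c * 0\<^sup>2..c * (0 + real (Suc n))\<^sup>2}) = {0..}"
  proof safe
    fix x :: real assume "0 \<le> x"
    obtain n where "x / c < real n"
      using reals_Archimedean2 by blast
    \<comment> \<open>Since n is at most the square of n + 1, an index chosen for
      \<open>x / c\<close> itself suffices and no square root is taken.\<close>
    also have "\<dots> \<le> (real (Suc n))\<^sup>2"
      by (simp add: power2_eq_square algebra_simps)
    finally show "x \<in> (\<Union>n. {c * 0\<^sup>2..c * (0 + real (Suc n))\<^sup>2})"
      using \<open>0 < c\<close> \<open>0 \<le> x\<close> by (auto intro!: exI[of _ n] simp: field_simps)
  qed (use \<open>0 < c\<close> in auto)
  moreover have "(\<integral>\<^sup>+x. f x * indicator (\<Union>n. {c * 0\<^sup>2..c * (0 + real (Suc n))\<^sup>2}) x \<partial>lborel) =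
    (\<integral>\<^sup>+x. f (c * x\<^sup>2) * ennreal (2 * c * x) * indicator {0..} x \<partial>lborel)"
    using \<open>0 < c\<close>
    by (intro nn_integral_substitution_atLeast)
       (auto intro!: derivative_eq_intros continuous_intros)
  ultimately show ?thesis
    by simp
qed

text \<open>On \<open>{0..}\<close> the function \<open>2 * arctan\<close> increases from 0 towards
  \<open>pi\<close> without attaining it, hence the half-open interval. Its inverse is the tangent
  of the half angle.\<close>

lemma nn_integral_substitution_arctan:
  fixes f :: "real \<Rightarrow> ennreal"
  assumes [measurable]: "f \<in> borel_measurable borel"
  shows "(\<integral>\<^sup>+x. f x * indicator {0..<pi} x \<partial>lborel) =
    (\<integral>\<^sup>+x. f (2 * arctan x) * ennreal (2 / (1 + x\<^sup>2)) * indicator {0..} x \<partial>lborel)"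
proof -
  have "(\<Union>n. {2 * arctan 0..2 * arctan (0 + real (Suc n))}) = {0..<pi}"
  proof safe
    fix x :: real assume x: "x \<in> {0..<pi}"
    obtain n where "tan (x / 2) < real n"
      using reals_Archimedean2 by blast
    then have "arctan (tan (x / 2)) \<le> arctan (real (Suc n))"
      unfolding arctan_le_iff by simp
    moreover have "arctan (tan (x / 2)) = x / 2"
      using x by (intro arctan_tan) auto
    ultimately show "x \<in> (\<Union>n. {2 * arctan 0..2 * arctan (0 + real (Suc n))})"
      using x by (auto intro!: exI[of _ n])
  next
    fix x n assume "x \<in> {2 * arctan 0..2 * arctan (0 + real (Suc n))}"
    then show "x \<in> {0..<pi}"
      using arctan_ubound[of "real (Suc n)"] by auto
  qed
  moreover have "(\<integral>\<^sup>+x. f x * indicator (\<Union>n. {2 * arctan 0..2 * arctan (0 + real (Suc n))}) x \<partial>lborel) =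
    (\<integral>\<^sup>+x. f (2 * arctan x) * ennreal (2 / (1 + x\<^sup>2)) * indicator {0..} x \<partial>lborel)"
  proof (intro nn_integral_substitution_atLeast)
    fix x :: real
    show "((\<lambda>x. 2 * arctan x) has_real_derivative 2 / (1 + x\<^sup>2)) (at x)"
      using DERIV_cmult[OF DERIV_arctan[of x], of 2] by (simp add: divide_inverse)
    show "0 \<le> 2 / (1 + x\<^sup>2)"
      by simp
  next
    have "1 + x\<^sup>2 \<noteq> 0" for x :: real
      using zero_le_power2[of x] by linarith
    then show "continuous_on {0..} (\<lambda>x::real. 2 / (1 + x\<^sup>2))"
      by (intro continuous_intros) auto
  qed simp
  ultimately show ?thesis
    by simp
qed

lemma nn_integral_even:
  fixes f :: "real \<Rightarrow> ennreal"
  assumes [measurable]: "f \<in> borel_measurable borel" and even: "\<And>x. f (- x) = f x"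
  shows "(\<integral>\<^sup>+x. f x \<partial>lborel) = 2 * (\<integral>\<^sup>+x. f x * indicator {0..} x \<partial>lborel)"
proof -
  have "(\<integral>\<^sup>+x. f x \<partial>lborel) = (\<integral>\<^sup>+x. f x * indicator {0..} x + f x * indicator {..0} x \<partial>lborel)"
    \<comment> \<open>The two half-lines share the point 0, so the integrands agree only off this
      null set.\<close>
    by (intro nn_integral_cong_AE AE_I[where N = "{0}"]) (auto split: split_indicator)
  also have "\<dots> = (\<integral>\<^sup>+x. f x * indicator {0..} x \<partial>lborel) + (\<integral>\<^sup>+x. f x * indicator {..0} x \<partial>lborel)"
    by (intro nn_integral_add) auto
  also have "(\<integral>\<^sup>+x. f x * indicator {..0} x \<partial>lborel) = (\<integral>\<^sup>+x. f x * indicator {0..} x \<partial>lborel)"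
    by (subst nn_integral_real_affine[where c = "-1" and t = 0])
       (auto simp: even intro!: nn_integral_cong split: split_indicator)
  finally show ?thesis
    by (simp add: mult_2)
qed

section \<open>The mean \<open>hoyt_snr\<close>: half-angle form, positivity, measurability\<close>

lemma cos_double_arctan: "cos (2 * arctan x) = (1 - x\<^sup>2) / (1 + x\<^sup>2)"
proof -
  have "0 < 1 + x\<^sup>2"
    by (simp add: add_pos_nonneg)
  then show ?thesis
    unfolding cos_double_cos by (simp add: cos_arctan power_divide field_simps)
qed

text \<open>For these parameters the amplitude of the cosine in \<open>hoyt_snr\<close> collapses to
  \<open>\<sigma>\<^sub>x\<^sup>2 - \<sigma>\<^sub>y\<^sup>2\<close>; the half-angle formula then
  gives a rational function of \<open>s\<close>. It is the exponential mean found on the ray of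
  slope \<open>s\<close> in the Gaussian integral.\<close>

lemma hoyt_snr_double_arctan:
  assumes "0 < \<sigma>\<^sub>x"
  shows "hoyt_snr (\<sigma>\<^sub>x\<^sup>2 + \<sigma>\<^sub>y\<^sup>2) (\<sigma>\<^sub>y / \<sigma>\<^sub>x) (2 * arctan s) = 2 * (\<sigma>\<^sub>x\<^sup>2 * s\<^sup>2 + \<sigma>\<^sub>y\<^sup>2) / (1 + s\<^sup>2)"
proof -
  have pos: "0 < \<sigma>\<^sub>x\<^sup>2 + \<sigma>\<^sub>y\<^sup>2" "0 < 1 + s\<^sup>2"
    using assms by (simp_all add: add_pos_nonneg)
  have "(1 - (\<sigma>\<^sub>y / \<sigma>\<^sub>x)\<^sup>2) / (1 + (\<sigma>\<^sub>y / \<sigma>\<^sub>x)\<^sup>2) = (\<sigma>\<^sub>x\<^sup>2 - \<sigma>\<^sub>y\<^sup>2) / (\<sigma>\<^sub>x\<^sup>2 + \<sigma>\<^sub>y\<^sup>2)"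
    using assms pos by (simp add: power_divide divide_simps)
  then have "(\<sigma>\<^sub>x\<^sup>2 + \<sigma>\<^sub>y\<^sup>2) * ((1 - (\<sigma>\<^sub>y / \<sigma>\<^sub>x)\<^sup>2) / (1 + (\<sigma>\<^sub>y / \<sigma>\<^sub>x)\<^sup>2)) = \<sigma>\<^sub>x\<^sup>2 - \<sigma>\<^sub>y\<^sup>2"
    using pos(1) by simp
  then have "hoyt_snr (\<sigma>\<^sub>x\<^sup>2 + \<sigma>\<^sub>y\<^sup>2) (\<sigma>\<^sub>y / \<sigma>\<^sub>x) (2 * arctan s) =
      (\<sigma>\<^sub>x\<^sup>2 + \<sigma>\<^sub>y\<^sup>2) - (\<sigma>\<^sub>x\<^sup>2 - \<sigma>\<^sub>y\<^sup>2) * ((1 - s\<^sup>2) / (1 + s\<^sup>2))"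
    unfolding hoyt_snr_def cos_double_arctan right_diff_distrib mult.assoc[symmetric] by simp
  also have "\<dots> = 2 * (\<sigma>\<^sub>x\<^sup>2 * s\<^sup>2 + \<sigma>\<^sub>y\<^sup>2) / (1 + s\<^sup>2)"
    using pos(2) by (simp add: field_simps)
  finally show ?thesis .
qed

text \<open>The coefficient of the cosine has modulus at most 1 for every real \<open>q\<close>, and
  the cosine has modulus less than 1 inside the interval. The endpoint 0 must be excluded: there the
  mean vanishes when \<open>q = 0\<close>.\<close>

lemma hoyt_snr_pos:
  assumes "0 < \<gamma>" "\<theta> \<in> {0<..<pi}"
  shows "0 < hoyt_snr \<gamma> q \<theta>"
proof -
  have "0 < 1 + q\<^sup>2"
    by (simp add: add_pos_nonneg)
  then have "\<bar>(1 - q\<^sup>2) / (1 + q\<^sup>2)\<bar> \<le> 1"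
    by (simp add: abs_le_iff)
  moreover have "\<bar>cos \<theta>\<bar> < 1"
    using assms cos_monotone_0_pi[of 0 \<theta>] cos_monotone_0_pi[of \<theta> pi] by (auto simp: abs_less_iff)
  ultimately have "\<bar>(1 - q\<^sup>2) / (1 + q\<^sup>2)\<bar> * \<bar>cos \<theta>\<bar> \<le> 1 * \<bar>cos \<theta>\<bar>"
    by (intro mult_right_mono) auto
  then have "\<bar>(1 - q\<^sup>2) / (1 + q\<^sup>2) * cos \<theta>\<bar> \<le> \<bar>cos \<theta>\<bar>"
    unfolding abs_mult by simp
  with \<open>\<bar>cos \<theta>\<bar> < 1\<close> have "(1 - q\<^sup>2) / (1 + q\<^sup>2) * cos \<theta> < 1"
    by linarith
  then show ?thesis
    using assms by (simp add: hoyt_snr_def)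
qed

lemma borel_measurable_hoyt_snr [measurable]: "hoyt_snr \<gamma> q \<in> borel_measurable borel"
  unfolding hoyt_snr_def[abs_def] by measurable

lemma borel_measurable_rayleigh_pdf [measurable (raw)]:
  assumes [measurable]: "u \<in> borel_measurable N" "v \<in> borel_measurable N"
  shows "(\<lambda>x. rayleigh_pdf (u x) (v x)) \<in> borel_measurable N"
  unfolding rayleigh_pdf_def by measurable

section \<open>The planar Gaussian integral as a mixture of exponential laws\<close>

text \<open>This is the integral over \<open>y\<close> along one ray. The integrand is even; after
  folding, \<open>t = c * y\<^sup>2\<close> absorbs the factor \<open>y\<close> into
  \<open>dt = 2 * c * y dy\<close>, and the exponent \<open>d * y\<^sup>2 / 2\<close> becomes
  \<open>t\<close> divided by \<open>2 * c / d\<close>.\<close>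

lemma nn_integral_gaussian_ray:
  fixes g :: "real \<Rightarrow> ennreal"
  assumes [measurable]: "g \<in> borel_measurable borel" and "0 < c" and "0 < d"
  shows "(\<integral>\<^sup>+y. ennreal (\<bar>y\<bar> * exp (- (d * y\<^sup>2 / 2)) / (2 * pi)) * g (c * y\<^sup>2) \<partial>lborel) =
    ennreal (1 / (pi * d)) * (\<integral>\<^sup>+t. g t * ennreal (rayleigh_pdf (2 * c / d) t) * indicator {0..} t \<partial>lborel)"
proof -
  have "(\<integral>\<^sup>+y. ennreal (\<bar>y\<bar> * exp (- (d * y\<^sup>2 / 2)) / (2 * pi)) * g (c * y\<^sup>2) \<partial>lborel) =
      2 * (\<integral>\<^sup>+y. ennreal (\<bar>y\<bar> * exp (- (d * y\<^sup>2 / 2)) / (2 * pi)) * g (c * y\<^sup>2) * indicator {0..} y \<partial>lborel)"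
    by (rule nn_integral_even) auto
  also have "\<dots> = (\<integral>\<^sup>+y. 2 * (ennreal (\<bar>y\<bar> * exp (- (d * y\<^sup>2 / 2)) / (2 * pi)) * g (c * y\<^sup>2) * indicator {0..} y) \<partial>lborel)"
    by (intro nn_integral_cmult[symmetric]) measurable
  also have "\<dots> = (\<integral>\<^sup>+y. ennreal (1 / (pi * d)) * (g (c * y\<^sup>2) * ennreal (rayleigh_pdf (2 * c / d) (c * y\<^sup>2))) *
      ennreal (2 * c * y) * indicator {0..} y \<partial>lborel)"
  proof (intro nn_integral_cong)
    fix y :: real
    show "2 * (ennreal (\<bar>y\<bar> * exp (- (d * y\<^sup>2 / 2)) / (2 * pi)) * g (c * y\<^sup>2) * indicator {0..} y) =
      ennreal (1 / (pi * d)) * (g (c * y\<^sup>2) * ennreal (rayleigh_pdf (2 * c / d) (c * y\<^sup>2))) *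
      ennreal (2 * c * y) * indicator {0..} y"
    proof (cases "0 \<le> y")
      case True
      have "2 * ennreal (\<bar>y\<bar> * exp (- (d * y\<^sup>2 / 2)) / (2 * pi)) =
          ennreal (2 * (\<bar>y\<bar> * exp (- (d * y\<^sup>2 / 2)) / (2 * pi)))"
        by (subst ennreal_mult) auto
      \<comment> \<open>Both sides are y times the exponential over \<open>pi\<close>: on the right
        the factor \<open>d / (2 * c)\<close> of the exponential density cancels against
        \<open>1 / d\<close> and \<open>2 * c\<close>.\<close>
      also have "2 * (\<bar>y\<bar> * exp (- (d * y\<^sup>2 / 2)) / (2 * pi)) =
          1 / (pi * d) * rayleigh_pdf (2 * c / d) (c * y\<^sup>2) * (2 * c * y)"
        using assms True by (simp add: rayleigh_pdf_def field_simps)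
      also have "ennreal \<dots> = ennreal (1 / (pi * d)) * ennreal (rayleigh_pdf (2 * c / d) (c * y\<^sup>2)) * ennreal (2 * c * y)"
      proof -
        have "0 \<le> rayleigh_pdf (2 * c / d) (c * y\<^sup>2)" "0 \<le> 1 / (pi * d)" "0 \<le> 2 * c * y"
          using assms True by (simp_all add: rayleigh_pdf_def)
        then show ?thesis
          by (simp only: ennreal_mult mult_nonneg_nonneg)
      qed
      finally have *: "2 * ennreal (\<bar>y\<bar> * exp (- (d * y\<^sup>2 / 2)) / (2 * pi)) = \<dots>" .
      show ?thesis
        unfolding mult.assoc[symmetric] * by (simp add: ac_simps)
    qed simp
  qed
  also have "\<dots> = (\<integral>\<^sup>+t. ennreal (1 / (pi * d)) * (g t * ennreal (rayleigh_pdf (2 * c / d) t)) * indicator {0..} t \<partial>lborel)"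
    using \<open>0 < c\<close> by (intro nn_integral_substitution_square[symmetric]) measurable
  also have "\<dots> = ennreal (1 / (pi * d)) * (\<integral>\<^sup>+t. g t * ennreal (rayleigh_pdf (2 * c / d) t) * indicator {0..} t \<partial>lborel)"
    unfolding mult.assoc by (intro nn_integral_cmult) measurable
  finally show ?thesis .
qed

lemma nn_integral_gaussian_polar:
  fixes g :: "real \<Rightarrow> ennreal"
  assumes [measurable]: "g \<in> borel_measurable borel" and "0 < \<sigma>\<^sub>x"
  shows "(\<integral>\<^sup>+y. \<integral>\<^sup>+x. ennreal (std_normal_density x) * (ennreal (std_normal_density y) *
        g ((\<sigma>\<^sub>x * x)\<^sup>2 + (\<sigma>\<^sub>y * y)\<^sup>2)) \<partial>lborel \<partial>lborel) =
    (\<integral>\<^sup>+\<theta>. ennreal (1 / pi) * (\<integral>\<^sup>+t. g t * ennreal (rayleigh_pdf (hoyt_snr (\<sigma>\<^sub>x\<^sup>2 + \<sigma>\<^sub>y\<^sup>2) (\<sigma>\<^sub>y / \<sigma>\<^sub>x) \<theta>) t) *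
      indicator {0..} t \<partial>lborel) * indicator {0..<pi} \<theta> \<partial>lborel)"
    (is "(\<integral>\<^sup>+y. \<integral>\<^sup>+x. ?F x y \<partial>lborel \<partial>lborel) = (\<integral>\<^sup>+\<theta>. ?K \<theta> * indicator {0..<pi} \<theta> \<partial>lborel)")
proof -
  define c d where "c s = \<sigma>\<^sub>x\<^sup>2 * s\<^sup>2 + \<sigma>\<^sub>y\<^sup>2" and "d s = 1 + s\<^sup>2" for s :: real
  have d_pos: "0 < d s" for s
    by (simp add: d_def add_pos_nonneg)
  \<comment> \<open>The slope 0 is left out because \<open>c 0\<close> vanishes if
    \<open>\<sigma>\<^sub>y = 0\<close>; a single slope is a null set.\<close>
  have c_pos: "0 < c s" if "s \<noteq> 0" for s
    using that \<open>0 < \<sigma>\<^sub>x\<close> by (simp add: c_def add_pos_nonneg)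
  have snr: "hoyt_snr (\<sigma>\<^sub>x\<^sup>2 + \<sigma>\<^sub>y\<^sup>2) (\<sigma>\<^sub>y / \<sigma>\<^sub>x) (2 * arctan s) = 2 * c s / d s" for s
    using hoyt_snr_double_arctan[OF \<open>0 < \<sigma>\<^sub>x\<close>] by (simp add: c_def d_def)
  have [measurable]: "?K \<in> borel_measurable borel"
    by measurable
  \<comment> \<open>The Jacobian \<open>\<bar>y\<bar>\<close> of \<open>x = y * s\<close> is
    included, and both quadratic forms become multiples of \<open>y\<^sup>2\<close>. The summand 0
    matches the shape of the affine substitution rule.\<close>
  have F: "ennreal \<bar>y\<bar> * ?F (0 + y * s) y = ennreal (\<bar>y\<bar> * exp (- (d s * y\<^sup>2 / 2)) / (2 * pi)) * g (c s * y\<^sup>2)" for y s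
  proof -
    have "\<bar>y\<bar> * (std_normal_density (y * s) * std_normal_density y) = \<bar>y\<bar> * exp (- (d s * y\<^sup>2 / 2)) / (2 * pi)"
    proof -
      have "std_normal_density (y * s) * std_normal_density y =
          (1 / (sqrt (2 * pi) * sqrt (2 * pi))) * (exp (- (y * s)\<^sup>2 / 2) * exp (- y\<^sup>2 / 2))"
        by (simp add: std_normal_density_def)
      also have "sqrt (2 * pi) * sqrt (2 * pi) = 2 * pi"
        by simp
      also have "exp (- (y * s)\<^sup>2 / 2) * exp (- y\<^sup>2 / 2) = exp (- (d s * y\<^sup>2 / 2))"
        unfolding exp_add[symmetric] by (simp add: d_def power_mult_distrib field_simps)
      finally show ?thesis
        by simp
    qed
    moreover have "(\<sigma>\<^sub>x * (0 + y * s))\<^sup>2 + (\<sigma>\<^sub>y * y)\<^sup>2 = c s * y\<^sup>2"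
      by (simp add: c_def algebra_simps power_mult_distrib)
    then have "ennreal \<bar>y\<bar> * ?F (0 + y * s) y =
        ennreal (\<bar>y\<bar> * (std_normal_density (y * s) * std_normal_density y)) * g (c s * y\<^sup>2)"
      by (simp add: ennreal_mult mult.assoc)
    ultimately show ?thesis
      by simp
  qed
  have "(\<integral>\<^sup>+y. \<integral>\<^sup>+x. ?F x y \<partial>lborel \<partial>lborel) = (\<integral>\<^sup>+y. \<integral>\<^sup>+s. ennreal \<bar>y\<bar> * ?F (0 + y * s) y \<partial>lborel \<partial>lborel)"
  \<comment> \<open>At \<open>y = 0\<close> the substitution degenerates; this is a null
    set.\<close>
  proof (rule nn_integral_cong_AE, rule eventually_mono[OF AE_lborel_singleton[of 0]])
    fix y :: real assume "y \<noteq> 0"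
    then have "(\<integral>\<^sup>+x. ?F x y \<partial>lborel) = ennreal \<bar>y\<bar> * (\<integral>\<^sup>+s. ?F (0 + y * s) y \<partial>lborel)"
      by (intro nn_integral_real_affine) measurable
    also have "\<dots> = (\<integral>\<^sup>+s. ennreal \<bar>y\<bar> * ?F (0 + y * s) y \<partial>lborel)"
      by (intro nn_integral_cmult[symmetric]) measurable
    finally show "(\<integral>\<^sup>+x. ?F x y \<partial>lborel) = (\<integral>\<^sup>+s. ennreal \<bar>y\<bar> * ?F (0 + y * s) y \<partial>lborel)" .
  qed
  also have "\<dots> = (\<integral>\<^sup>+s. \<integral>\<^sup>+y. ennreal \<bar>y\<bar> * ?F (0 + y * s) y \<partial>lborel \<partial>lborel)"
    by (intro lborel_pair.Fubini') measurable
  also have "\<dots> = (\<integral>\<^sup>+s. ?K (2 * arctan s) * ennreal (1 / (1 + s\<^sup>2)) \<partial>lborel)"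
  proof (rule nn_integral_cong_AE, rule eventually_mono[OF AE_lborel_singleton[of 0]])
    fix s :: real assume "s \<noteq> 0"
    have "ennreal (1 / (pi * d s)) = ennreal (1 / pi) * ennreal (1 / (1 + s\<^sup>2))"
      using d_pos[of s] by (simp add: d_def flip: ennreal_mult)
    then show "(\<integral>\<^sup>+y. ennreal \<bar>y\<bar> * ?F (0 + y * s) y \<partial>lborel) = ?K (2 * arctan s) * ennreal (1 / (1 + s\<^sup>2))"
      unfolding F nn_integral_gaussian_ray[OF assms(1) c_pos[OF \<open>s \<noteq> 0\<close>] d_pos] snr
      by (simp only: ac_simps)
  qed
  \<comment> \<open>The integrand depends on \<open>s\<close> only through its square. The factor 2
    from folding turns the weight into the derivative of \<open>2 * arctan s\<close>.\<close>
  also have "\<dots> = 2 * (\<integral>\<^sup>+s. ?K (2 * arctan s) * ennreal (1 / (1 + s\<^sup>2)) * indicator {0..} s \<partial>lborel)"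
    by (rule nn_integral_even) (measurable, simp add: snr c_def d_def)
  also have "\<dots> = (\<integral>\<^sup>+s. 2 * (?K (2 * arctan s) * ennreal (1 / (1 + s\<^sup>2)) * indicator {0..} s) \<partial>lborel)"
    by (intro nn_integral_cmult[symmetric]) measurable
  also have "\<dots> = (\<integral>\<^sup>+s. ?K (2 * arctan s) * ennreal (2 / (1 + s\<^sup>2)) * indicator {0..} s \<partial>lborel)"
  proof (intro nn_integral_cong)
    fix s :: real
    have *: "ennreal (2 / (1 + s\<^sup>2)) = 2 * ennreal (1 / (1 + s\<^sup>2))"
      using ennreal_mult[of 2 "1 / (1 + s\<^sup>2)"] by simp
    show "2 * (?K (2 * arctan s) * ennreal (1 / (1 + s\<^sup>2)) * indicator {0..} s) =
        ?K (2 * arctan s) * ennreal (2 / (1 + s\<^sup>2)) * indicator {0..} s"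
      unfolding * by (simp only: ac_simps)
  qed
  also have "\<dots> = (\<integral>\<^sup>+\<theta>. ?K \<theta> * indicator {0..<pi} \<theta> \<partial>lborel)"
    by (rule nn_integral_substitution_arctan[symmetric]) measurable
  finally show ?thesis .
qed

section \<open>Zero-mean Gaussian laws and their second moments\<close>

text \<open>Scaling by 0 pushes the standard normal law to the point mass at 0, so later
  computations treat the degenerate and the proper Gaussian alike.\<close>

lemma zero_mean_gaussian_eq_distr:
  assumes "0 \<le> \<sigma>"
  shows "zero_mean_gaussian \<sigma> = distr (density lborel std_normal_density) borel (\<lambda>x. \<sigma> * x)"
proof -
  let ?N = "density lborel std_normal_density"
  interpret N: prob_space ?N
    using prob_space_normal_density[of 1 0] by simp
  show ?thesis
  proof (cases "\<sigma> = 0")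
    case True
    have "distr ?N borel (\<lambda>x. 0 :: real) = return borel 0"
      by (rule N.distr_const) simp
    then show ?thesis
      using True by (simp add: zero_mean_gaussian_def)
  next
    case False
    \<comment> \<open>The identity serves as the standard normal random variable on the space
      \<open>?N\<close> itself.\<close>
    have "distributed ?N lborel (\<lambda>x. x) std_normal_density"
      by (auto simp: distributed_def intro!: distr_id2)
    then have "distributed ?N lborel (\<lambda>x. 0 + \<sigma> * x) (normal_density (0 + \<sigma> * 0) (\<bar>\<sigma>\<bar> * 1))"
      using False by (intro N.normal_density_affine) auto
    then have "distr ?N lborel (\<lambda>x. \<sigma> * x) = density lborel (normal_density 0 \<sigma>)"
      using assms by (simp add: distributed_def)
    moreover have "distr ?N lborel (\<lambda>x. \<sigma> * x) = distr ?N borel (\<lambda>x. \<sigma> * x)"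
      by (rule distr_cong) auto
    ultimately show ?thesis
      using False by (simp add: zero_mean_gaussian_def)
  qed
qed

lemma nn_integral_zero_mean_gaussian:
  assumes "0 \<le> \<sigma>" and [measurable]: "f \<in> borel_measurable borel"
  shows "(\<integral>\<^sup>+x. f x \<partial>zero_mean_gaussian \<sigma>) = (\<integral>\<^sup>+x. ennreal (std_normal_density x) * f (\<sigma> * x) \<partial>lborel)"
  unfolding zero_mean_gaussian_eq_distr[OF assms(1)]
  by (simp add: nn_integral_distr nn_integral_density)

text \<open>Used to compute the expectation of the sum of two squares; the form with
  \<open>has_bochner_integral\<close> carries the integrability that additivity requires.\<close>

lemma has_bochner_integral_gaussian_square:
  assumes "0 \<le> \<sigma>" and [measurable]: "X \<in> borel_measurable M"
    and distr: "distr M borel X = zero_mean_gaussian \<sigma>"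
  shows "has_bochner_integral M (\<lambda>\<omega>. (X \<omega>)\<^sup>2) (\<sigma>\<^sup>2)"
proof -
  have "(\<integral>\<^sup>+\<omega>. ennreal ((X \<omega>)\<^sup>2) \<partial>M) = (\<integral>\<^sup>+x. ennreal (x\<^sup>2) \<partial>distr M borel X)"
    by (subst nn_integral_distr) auto
  also have "\<dots> = (\<integral>\<^sup>+x. ennreal (\<sigma>\<^sup>2 * (std_normal_density x * x\<^sup>2)) \<partial>lborel)"
    unfolding distr using \<open>0 \<le> \<sigma>\<close>
    by (subst nn_integral_zero_mean_gaussian)
       (auto intro!: nn_integral_cong simp: power_mult_distrib mult.left_commute simp flip: ennreal_mult)
  also have "\<dots> = ennreal (\<integral>x. \<sigma>\<^sup>2 * (std_normal_density x * x\<^sup>2) \<partial>lborel)"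
    using integrable_std_normal_moment[of 2] by (intro nn_integral_eq_integral) auto
  \<comment> \<open>The standard normal moment of order 2k is (2k)! / (2^k k!), which is 1 for k =
    1.\<close>
  also have "(\<integral>x. \<sigma>\<^sup>2 * (std_normal_density x * x\<^sup>2) \<partial>lborel) = \<sigma>\<^sup>2"
    using integral_std_normal_moment_even[of 1] by (simp add: fact_numeral)
  finally show ?thesis
    by (intro has_bochner_integral_nn_integral) auto
qed

section \<open>The density of the squared Hoyt law\<close>

text \<open>The mixture is shown to be a density of \<open>Z\<close> by evaluating both measures on
  Borel sets; densities with respect to \<open>lborel\<close> are unique only almost everywhere, and
  \<open>f\<close> is an arbitrary version.\<close>

lemma squared_hoyt_density:
  assumes "squared_hoyt M Z \<gamma> q" and Z: "distributed M lborel Z f"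
  shows "AE t in lborel. f t = (\<integral>\<^sup>+\<theta>. ennreal (1 / pi) * ennreal (rayleigh_pdf (hoyt_snr \<gamma> q \<theta>) t) *
    indicator {0<..<pi} \<theta> * indicator {0..} t \<partial>lborel)"
proof -
  obtain X Y \<sigma>\<^sub>x \<sigma>\<^sub>y where sigma: "0 < \<sigma>\<^sub>x" "0 \<le> \<sigma>\<^sub>y"
    and M: "prob_space M" and indep: "prob_space.indep_var M borel X borel Y"
    and X: "distr M borel X = zero_mean_gaussian \<sigma>\<^sub>x"
    and Y: "distr M borel Y = zero_mean_gaussian \<sigma>\<^sub>y"
    and Z_eq: "Z = (\<lambda>\<omega>. (X \<omega>)\<^sup>2 + (Y \<omega>)\<^sup>2)"
    and \<gamma>: "\<gamma> = prob_space.expectation M Z" and q: "q = \<sigma>\<^sub>y / \<sigma>\<^sub>x"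
    using assms(1) unfolding squared_hoyt_def by blast
  interpret prob_space M
    by fact
  have [measurable]: "X \<in> borel_measurable M" "Y \<in> borel_measurable M"
    and joint: "distr M borel X \<Otimes>\<^sub>M distr M borel Y = distr M (borel \<Otimes>\<^sub>M borel) (\<lambda>\<omega>. (X \<omega>, Y \<omega>))"
    using indep unfolding indep_var_distribution_eq by auto
  interpret Y: prob_space "distr M borel Y"
    by (rule prob_space_distr) simp
  have "has_bochner_integral M Z (\<sigma>\<^sub>x\<^sup>2 + \<sigma>\<^sub>y\<^sup>2)"
    unfolding Z_eq using sigma X Y
    by (intro has_bochner_integral_add has_bochner_integral_gaussian_square) auto
  then have \<gamma>_eq: "\<gamma> = \<sigma>\<^sub>x\<^sup>2 + \<sigma>\<^sub>y\<^sup>2"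
    unfolding \<gamma> by (rule has_bochner_integral_integral_eq)
  define P where "P t = (\<integral>\<^sup>+\<theta>. ennreal (1 / pi) * ennreal (rayleigh_pdf (hoyt_snr \<gamma> q \<theta>) t) *
    indicator {0<..<pi} \<theta> * indicator {0..} t \<partial>lborel)" for t
  have [measurable]: "P \<in> borel_measurable borel"
    unfolding P_def[abs_def] by measurable
  have f_measurable: "f \<in> borel_measurable lborel" and distr_f: "distr M lborel Z = density lborel f"
    using Z by (auto simp: distributed_def)
  have Z_measurable: "Z \<in> measurable M lborel"
    using Z by (simp add: distributed_def)
  have "distr M lborel Z = density lborel P"
  proof (rule measure_eqI)
    fix A assume "A \<in> sets (distr M lborel Z)"
    then have [measurable]: "A \<in> sets borel"
      by simp
    have "emeasure (distr M lborel Z) A = (\<integral>\<^sup>+t. indicator A t \<partial>distr M lborel Z)"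
      by simp
    also have "\<dots> = (\<integral>\<^sup>+\<omega>. indicator A (Z \<omega>) \<partial>M)"
      using Z_measurable by (intro nn_integral_distr) auto
    also have "\<dots> = (\<integral>\<^sup>+z. indicator A ((fst z)\<^sup>2 + (snd z)\<^sup>2) \<partial>distr M (borel \<Otimes>\<^sub>M borel) (\<lambda>\<omega>. (X \<omega>, Y \<omega>)))"
      unfolding Z_eq by (subst nn_integral_distr) auto
    also have "\<dots> = (\<integral>\<^sup>+x. \<integral>\<^sup>+y. indicator A (x\<^sup>2 + y\<^sup>2) \<partial>distr M borel Y \<partial>distr M borel X)"
      unfolding joint[symmetric] by (subst Y.nn_integral_fst[symmetric]) auto
    also have "\<dots> = (\<integral>\<^sup>+x. ennreal (std_normal_density x) * (\<integral>\<^sup>+y. ennreal (std_normal_density y) *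
        indicator A ((\<sigma>\<^sub>x * x)\<^sup>2 + (\<sigma>\<^sub>y * y)\<^sup>2) \<partial>lborel) \<partial>lborel)"
      unfolding X Y using sigma by (simp add: nn_integral_zero_mean_gaussian)
    also have "\<dots> = (\<integral>\<^sup>+x. \<integral>\<^sup>+y. ennreal (std_normal_density x) * (ennreal (std_normal_density y) *
        indicator A ((\<sigma>\<^sub>x * x)\<^sup>2 + (\<sigma>\<^sub>y * y)\<^sup>2)) \<partial>lborel \<partial>lborel)"
      by (intro nn_integral_cong nn_integral_cmult[symmetric]) measurable
    \<comment> \<open>Tonelli makes \<open>x\<close> the inner variable, the one replaced by
      \<open>y * s\<close> in \<open>nn_integral_gaussian_polar\<close>; the test function there is
      the indicator of \<open>A\<close>.\<close>
    also have "\<dots> = (\<integral>\<^sup>+y. \<integral>\<^sup>+x. ennreal (std_normal_density x) * (ennreal (std_normal_density y) *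
        indicator A ((\<sigma>\<^sub>x * x)\<^sup>2 + (\<sigma>\<^sub>y * y)\<^sup>2)) \<partial>lborel \<partial>lborel)"
      by (intro lborel_pair.Fubini'[symmetric]) measurable
    also have "\<dots> = (\<integral>\<^sup>+\<theta>. ennreal (1 / pi) * (\<integral>\<^sup>+t. indicator A t *
        ennreal (rayleigh_pdf (hoyt_snr \<gamma> q \<theta>) t) * indicator {0..} t \<partial>lborel) * indicator {0..<pi} \<theta> \<partial>lborel)"
      unfolding \<gamma>_eq q using \<open>0 < \<sigma>\<^sub>x\<close> by (intro nn_integral_gaussian_polar) measurable
    also have "\<dots> = (\<integral>\<^sup>+\<theta>. \<integral>\<^sup>+t. ennreal (1 / pi) * ennreal (rayleigh_pdf (hoyt_snr \<gamma> q \<theta>) t) *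
        indicator {0<..<pi} \<theta> * indicator {0..} t * indicator A t \<partial>lborel \<partial>lborel)"
    \<comment> \<open>Dropping the null point 0 passes to the open interval, on which
      \<open>hoyt_snr_pos\<close> applies.\<close>
    proof (rule nn_integral_cong_AE, rule eventually_mono[OF AE_lborel_singleton[of 0]])
      fix \<theta> :: real assume "\<theta> \<noteq> 0"
      then have ind: "indicator {0..<pi} \<theta> = (indicator {0<..<pi} \<theta> :: ennreal)"
        by (auto split: split_indicator)
      have "ennreal (1 / pi) * (\<integral>\<^sup>+t. indicator A t * ennreal (rayleigh_pdf (hoyt_snr \<gamma> q \<theta>) t) *
          indicator {0..} t \<partial>lborel) * indicator {0..<pi} \<theta> =
        ennreal (1 / pi) * indicator {0<..<pi} \<theta> * (\<integral>\<^sup>+t. indicator A t *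
          ennreal (rayleigh_pdf (hoyt_snr \<gamma> q \<theta>) t) * indicator {0..} t \<partial>lborel)"
        unfolding ind by (simp only: ac_simps)
      also have "\<dots> = (\<integral>\<^sup>+t. ennreal (1 / pi) * indicator {0<..<pi} \<theta> * (indicator A t *
          ennreal (rayleigh_pdf (hoyt_snr \<gamma> q \<theta>) t) * indicator {0..} t) \<partial>lborel)"
        by (intro nn_integral_cmult[symmetric]) measurable
      finally show "ennreal (1 / pi) * (\<integral>\<^sup>+t. indicator A t * ennreal (rayleigh_pdf (hoyt_snr \<gamma> q \<theta>) t) *
          indicator {0..} t \<partial>lborel) * indicator {0..<pi} \<theta> =
        (\<integral>\<^sup>+t. ennreal (1 / pi) * ennreal (rayleigh_pdf (hoyt_snr \<gamma> q \<theta>) t) *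
          indicator {0<..<pi} \<theta> * indicator {0..} t * indicator A t \<partial>lborel)"
        by (simp only: ac_simps)
    qed
    also have "\<dots> = (\<integral>\<^sup>+t. \<integral>\<^sup>+\<theta>. ennreal (1 / pi) * ennreal (rayleigh_pdf (hoyt_snr \<gamma> q \<theta>) t) *
        indicator {0<..<pi} \<theta> * indicator {0..} t * indicator A t \<partial>lborel \<partial>lborel)"
      by (intro lborel_pair.Fubini'[symmetric]) measurable
    also have "\<dots> = (\<integral>\<^sup>+t. P t * indicator A t \<partial>lborel)"
      unfolding P_def by (intro nn_integral_cong nn_integral_multc) measurable
    also have "\<dots> = emeasure (density lborel P) A"
      by (simp add: emeasure_density)
    finally show "emeasure (distr M lborel Z) A = emeasure (density lborel P) A" .
  qed simp
  then have "AE t in lborel. f t = P t"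
    using f_measurable distr_f by (intro sigma_finite_measure.density_unique[OF sigma_finite_lborel]) auto
  then show ?thesis
    unfolding P_def .
qed

section \<open>Exchanging the average of the metric with the mixture\<close>

theorem lemma2:
  fixes M :: "'a measure" and Z :: "'a \<Rightarrow> real"
    and h f :: "real \<Rightarrow> real" and a \<gamma> q :: real and b :: ereal
  assumes "0 \<le> a" and "ereal a < b"
    and "0 < \<gamma>" and "0 \<le> q" and "q \<le> 1"
    and "squared_hoyt M Z \<gamma> q"
    and "\<And>x. 0 \<le> f x"
    and "distributed M lborel Z (\<lambda>x. ennreal (f x))"
    and "set_borel_measurable borel (einterval (ereal a) b) h"
    and "interval_lebesgue_integrable lborel (ereal a) b (\<lambda>x. h x * f x)"
  shows "(AE \<theta> in lborel. \<theta> \<in> {0<..<pi} \<longrightarrow>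
      interval_lebesgue_integrable lborel (ereal a) b
        (\<lambda>x. h x * rayleigh_pdf (hoyt_snr \<gamma> q \<theta>) x)) \<and>
    interval_lebesgue_integrable lborel (ereal 0) (ereal pi)
      (\<lambda>\<theta>. rayleigh_metric h a b (hoyt_snr \<gamma> q \<theta>)) \<and>
    average_metric h a b f =
      1 / pi * (LBINT \<theta>=ereal 0..ereal pi. rayleigh_metric h a b (hoyt_snr \<gamma> q \<theta>)) \<and>
    average_metric h a b f = hoyt_transform (rayleigh_metric h a b) q \<gamma>"
proof -
  define S where "S = einterval (ereal a) b"
  have S_nonneg: "0 \<le> x" if "x \<in> S" for x
    using that \<open>0 \<le> a\<close> by (auto simp: S_def einterval_def)
  \<comment> \<open>\<open>h\<close> is assumed measurable only on the averaging interval. Extension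
    by 0 gives a Borel function and turns interval integrals into integrals over the line.\<close>
  define h\<^sub>S where "h\<^sub>S x = indicator S x * h x" for x
  have [measurable]: "h\<^sub>S \<in> borel_measurable borel"
    using assms(9) by (simp add: set_borel_measurable_def h\<^sub>S_def[abs_def] S_def)
  have metric: "average_metric h a b p = (\<integral>x. h\<^sub>S x * p x \<partial>lborel)" for p
    using \<open>ereal a < b\<close>
    by (simp add: average_metric_def interval_lebesgue_integral_def set_lebesgue_integral_def
        h\<^sub>S_def S_def mult.assoc)
  have integrable_iff: "interval_lebesgue_integrable lborel (ereal a) b (\<lambda>x. h x * p x) \<longleftrightarrow>
      integrable lborel (\<lambda>x. h\<^sub>S x * p x)" for p
    using \<open>ereal a < b\<close>
    by (simp add: interval_lebesgue_integrable_def set_integrable_def h\<^sub>S_def S_def mult.assoc)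
  \<comment> \<open>The mixture kernel as a real function of both variables. The open interval keeps
    the mean positive, and hence \<open>\<kappa>\<close> nonnegative.\<close>
  define \<kappa> where "\<kappa> \<theta> x = 1 / pi * rayleigh_pdf (hoyt_snr \<gamma> q \<theta>) x * indicator {0<..<pi} \<theta>" for \<theta> x
  have [measurable]: "(\<lambda>(\<theta>, x). \<kappa> \<theta> x) \<in> borel_measurable (borel \<Otimes>\<^sub>M borel)"
    unfolding \<kappa>_def by measurable
  have \<kappa>_nonneg: "0 \<le> \<kappa> \<theta> x" for \<theta> x
    using hoyt_snr_pos[OF \<open>0 < \<gamma>\<close>, of \<theta> q]
    by (auto simp: \<kappa>_def rayleigh_pdf_def less_imp_le split: split_indicator)
  have density: "AE x in lborel. 0 \<le> x \<longrightarrow> ennreal (f x) = (\<integral>\<^sup>+\<theta>. ennreal (\<kappa> \<theta> x) \<partial>lborel)"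
    using squared_hoyt_density[OF assms(6,8)]
  proof eventually_elim
    case (elim x)
    have "ennreal (1 / pi) * ennreal (rayleigh_pdf (hoyt_snr \<gamma> q \<theta>) x) * indicator {0<..<pi} \<theta> = ennreal (\<kappa> \<theta> x)" for \<theta>
      by (auto simp: \<kappa>_def simp flip: ennreal_mult' split: split_indicator)
    with elim show ?case
      by simp
  qed
  \<comment> \<open>Tonelli for the absolute value: integrating \<open>\<kappa>\<close> over the
    angle restores \<open>f\<close>, so the integrability of \<open>h * f\<close> yields
    integrability on the product space.\<close>
  have "(\<integral>\<^sup>+\<theta>. \<integral>\<^sup>+x. ennreal (norm (h\<^sub>S x * \<kappa> \<theta> x)) \<partial>lborel \<partial>lborel) =
      (\<integral>\<^sup>+x. \<integral>\<^sup>+\<theta>. ennreal (norm (h\<^sub>S x * \<kappa> \<theta> x)) \<partial>lborel \<partial>lborel)"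
    by (intro lborel_pair.Fubini'[symmetric]) measurable
  also have "\<dots> = (\<integral>\<^sup>+x. ennreal (norm (h\<^sub>S x * f x)) \<partial>lborel)"
  proof (rule nn_integral_cong_AE, rule eventually_mono[OF density])
    fix x :: real assume x: "0 \<le> x \<longrightarrow> ennreal (f x) = (\<integral>\<^sup>+\<theta>. ennreal (\<kappa> \<theta> x) \<partial>lborel)"
    have "(\<integral>\<^sup>+\<theta>. ennreal (norm (h\<^sub>S x * \<kappa> \<theta> x)) \<partial>lborel) = (\<integral>\<^sup>+\<theta>. ennreal \<bar>h\<^sub>S x\<bar> * ennreal (\<kappa> \<theta> x) \<partial>lborel)"
      by (simp add: abs_mult \<kappa>_nonneg ennreal_mult)
    also have "\<dots> = ennreal \<bar>h\<^sub>S x\<bar> * (\<integral>\<^sup>+\<theta>. ennreal (\<kappa> \<theta> x) \<partial>lborel)"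
      by (intro nn_integral_cmult) measurable
    also have "\<dots> = ennreal \<bar>h\<^sub>S x\<bar> * ennreal (f x)"
    \<comment> \<open>The mixture formula is available for \<open>0 \<le> x\<close>, which holds on
      \<open>S\<close> because \<open>0 \<le> a\<close>; off \<open>S\<close> the factor
      \<open>h\<^sub>S x\<close> is 0.\<close>
    proof (cases "x \<in> S")
      case True
      then show ?thesis
        using x S_nonneg by simp
    qed (simp add: h\<^sub>S_def)
    finally show "(\<integral>\<^sup>+\<theta>. ennreal (norm (h\<^sub>S x * \<kappa> \<theta> x)) \<partial>lborel) = ennreal (norm (h\<^sub>S x * f x))"
      using assms(7)[of x] by (simp add: abs_mult ennreal_mult)
  qed
  also have "\<dots> < \<infinity>"
    using assms(10) unfolding integrable_iff by (simp add: integrable_iff_bounded)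
  finally have "(\<integral>\<^sup>+z. ennreal (norm (h\<^sub>S (snd z) * \<kappa> (fst z) (snd z))) \<partial>(lborel \<Otimes>\<^sub>M lborel)) < \<infinity>"
    by (subst lborel.nn_integral_fst[symmetric]) simp_all
  then have int: "integrable (lborel \<Otimes>\<^sub>M lborel) (\<lambda>(\<theta>, x). h\<^sub>S x * \<kappa> \<theta> x)"
    by (intro integrableI_bounded) (simp_all add: case_prod_beta)
  \<comment> \<open>This holds for every angle: pulling out a constant is valid even without
    integrability, as the integral then defaults to 0 on both sides.\<close>
  have inner: "(\<integral>x. h\<^sub>S x * \<kappa> \<theta> x \<partial>lborel) =
      1 / pi * (indicator {0<..<pi} \<theta> * rayleigh_metric h a b (hoyt_snr \<gamma> q \<theta>))" for \<theta>
  proof -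
    have "(\<integral>x. h\<^sub>S x * \<kappa> \<theta> x \<partial>lborel) =
        (\<integral>x. (1 / pi * indicator {0<..<pi} \<theta>) * (h\<^sub>S x * rayleigh_pdf (hoyt_snr \<gamma> q \<theta>) x) \<partial>lborel)"
      by (simp add: \<kappa>_def ac_simps)
    then show ?thesis
      by (simp only: integral_mult_right_zero rayleigh_metric_def metric mult.assoc)
  qed
  have "AE \<theta> in lborel. integrable lborel (\<lambda>x. h\<^sub>S x * \<kappa> \<theta> x)"
    using lborel_pair.AE_integrable_fst'[OF int] by simp
  then have "AE \<theta> in lborel. \<theta> \<in> {0<..<pi} \<longrightarrow>
      interval_lebesgue_integrable lborel (ereal a) b (\<lambda>x. h x * rayleigh_pdf (hoyt_snr \<gamma> q \<theta>) x)"
  proof eventually_elim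
    case (elim \<theta>)
    show ?case
    proof
      assume "\<theta> \<in> {0<..<pi}"
      \<comment> \<open>Multiplication by \<open>pi\<close> undoes the normalisation in
        \<open>\<kappa>\<close>.\<close>
      then have "(\<lambda>x. pi * (h\<^sub>S x * \<kappa> \<theta> x)) = (\<lambda>x. h\<^sub>S x * rayleigh_pdf (hoyt_snr \<gamma> q \<theta>) x)"
        by (simp add: \<kappa>_def)
      with integrable_mult_right[OF elim, of pi]
      show "interval_lebesgue_integrable lborel (ereal a) b (\<lambda>x. h x * rayleigh_pdf (hoyt_snr \<gamma> q \<theta>) x)"
        unfolding integrable_iff by simp
    qed
  qed
  moreover have "integrable lborel (\<lambda>\<theta>. pi * (\<integral>x. h\<^sub>S x * \<kappa> \<theta> x \<partial>lborel))"
    using lborel_pair.integrable_fst'[OF int] by simp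
  then have "interval_lebesgue_integrable lborel (ereal 0) (ereal pi)
      (\<lambda>\<theta>. rayleigh_metric h a b (hoyt_snr \<gamma> q \<theta>))"
    unfolding inner by (simp add: interval_lebesgue_integrable_def set_integrable_def)
  moreover have "average_metric h a b f =
      1 / pi * (LBINT \<theta>=ereal 0..ereal pi. rayleigh_metric h a b (hoyt_snr \<gamma> q \<theta>))"
  proof -
    have "average_metric h a b f = (\<integral>x. \<integral>\<theta>. h\<^sub>S x * \<kappa> \<theta> x \<partial>lborel \<partial>lborel)"
      unfolding metric
    proof (rule integral_cong_AE)
      have [measurable]: "f \<in> borel_measurable borel"
        using distributed_real_measurable[of lborel f M Z] assms(7,8) by simp
      show "(\<lambda>x. h\<^sub>S x * f x) \<in> borel_measurable lborel"
        by measurable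
      show "(\<lambda>x. \<integral>\<theta>. h\<^sub>S x * \<kappa> \<theta> x \<partial>lborel) \<in> borel_measurable lborel"
        by measurable
      show "AE x in lborel. h\<^sub>S x * f x = (\<integral>\<theta>. h\<^sub>S x * \<kappa> \<theta> x \<partial>lborel)"
        using density
      proof eventually_elim
        case (elim x)
        show ?case
        proof (cases "x \<in> S")
          case True
          \<comment> \<open>The nonnegative integral equals \<open>ennreal (f x)\<close>, which is
            finite, so its real value is \<open>f x\<close> by nonnegativity of
            \<open>f\<close>.\<close>
          have "(\<integral>\<theta>. \<kappa> \<theta> x \<partial>lborel) = enn2real (\<integral>\<^sup>+\<theta>. ennreal (\<kappa> \<theta> x) \<partial>lborel)"
            by (intro integral_eq_nn_integral) (auto simp: \<kappa>_nonneg)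
          also have "\<dots> = f x"
            using elim S_nonneg[OF True] assms(7)[of x] by (simp flip: elim)
          finally show ?thesis
            by simp
        qed (simp add: h\<^sub>S_def)
      qed
    qed
    also have "\<dots> = (\<integral>\<theta>. \<integral>x. h\<^sub>S x * \<kappa> \<theta> x \<partial>lborel \<partial>lborel)"
      by (rule lborel_pair.Fubini_integral[OF int])
    also have "\<dots> = 1 / pi * (LBINT \<theta>=ereal 0..ereal pi. rayleigh_metric h a b (hoyt_snr \<gamma> q \<theta>))"
      unfolding inner integral_mult_right_zero
      by (simp add: interval_lebesgue_integral_def set_lebesgue_integral_def)
    finally show ?thesis .
  qed
  ultimately show ?thesis
    by (simp add: hoyt_transform_def)
qed

end
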